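(* Let $p\ge 2$ and $m\ge 1$ be integers. Let $x_k(z)=\sum_{i=0}^{\infty}c_{k,i}z^i$ ($|z|<1$, $k\ge 0$) be the power series expansions of the scalar Schröder iterates for $(1-z)^{1/p}$, and let $b_i$ be the binomial coefficients in $(1-z)^{1/p}=\sum_{i=0}^\infty b_i z^i$. Then for each $i\ge 1$, the sequence $(c_{k,i})_{k\ge 0}$ decreases as $k$ increases (i.e. $c_{k+1,i}\le c_{k,i}$ for all $k\ge 0$) and $c_{k,i}=b_i$ for all sufficiently large $k$. In particular, $c_{k,i}\le 0$ for all $k\ge 0$ and $i\ge 1$. Moreover, $c_{k,i}<0$ for all $k\ge 2$ and $i\ge 1$.
   Context: For real $x$ and integer $i\ge 0$, $(x)_i=x(x+1)\cdots(x+i-1)$, with $(x)_0=1$. The coefficients $b_i$ are $b_0=1$ and $b_i=\frac{(-1/p)_i}{i!}$ for $i\ge 1$, so $(1-t)^{1/p}=\sum_{i=0}^\infty b_i t^i$ for $|t|<1$. Let $T_m(t)=\sum_{i=0}^m b_i t^i$. For $|z|<1$, Schröder's method (with parameter $m$) for $(1-z)^{1/p}$ is the iteration $x_0(z)=1$, $x_{k+1}(z)=x_k(z)\,T_m\big(1-(1-z)x_k(z)^{-p}\big)$ for $k\ge 0$. Each $x_k(z)$ has a power series expansion $x_k(z)=\sum_{i=0}^\infty c_{k,i}z^i$ for $|z|<1$, which defines $c_{k,i}$. *)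

theory Defs
  imports Complex_Main
begin

definition root_coeff :: "nat \<Rightarrow> nat \<Rightarrow> real" where
  "root_coeff p i = pochhammer (- 1 / real p) i / fact i"

definition root_taylor :: "nat \<Rightarrow> nat \<Rightarrow> complex \<Rightarrow> complex" where
  "root_taylor p m t = (\<Sum>i\<le>m. of_real (root_coeff p i) * t ^ i)"

primrec schroeder_iter :: "nat \<Rightarrow> nat \<Rightarrow> nat \<Rightarrow> complex \<Rightarrow> complex" where
  "schroeder_iter p m 0 z = 1"
| "schroeder_iter p m (Suc k) z =
     schroeder_iter p m k z * root_taylor p m (1 - (1 - z) / schroeder_iter p m k z ^ p)"

(* Coefficients of a power series converging on a disc are unique, so the description is proper
   as soon as some real expansion on the whole open unit disc exists. *)
definition schroeder_coeff :: "nat \<Rightarrow> nat \<Rightarrow> nat \<Rightarrow> nat \<Rightarrow> real" where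
  "schroeder_coeff p m k =
     (THE c. \<forall>z. norm z < 1 \<longrightarrow> (\<lambda>i. of_real (c i) * z ^ i) sums schroeder_iter p m k z)"

end

theory Submission
  imports Defs "HOL-Complex_Analysis.Complex_Analysis" "HOL-Library.Complex_Order"
begin

text \<open>
  The residuals $r_k = 1 - (1-z) x_k^{-p}$ satisfy $r_{k+1} = f(r_k)$ for the fixed series
  $f = 1 - (1-t) T^{-p}$, where $T = T_m$. Truncating the differential equation of $(1-t)^{1/p}$
  gives $T + p (1-t) T' = c t^m$ with $c > 0$, so $f' = c t^m T^{-p-1}$ has nonnegative
  coefficients, because those of $1/T$ are positive. On the unit disc this yields
  $|f(t)| \<le> f(|t|) < 1$, so all iterates are holomorphic there.

  Put $W = (1-t) T^{1-p}$, so that $T f = T - W$. The same equation gives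
  $p W' = - T^{1-p} - (p-1) c t^m T^{-p}$, so $T f$ has nonnegative coefficients too. Since
  $x_{k+1} r_{k+1} = x_k (T f)(r_k)$ and $T f$ is divisible by $t$, the coefficients of $x_k r_k$
  are nonnegative by induction, and hence so are those of $x_k - x_{k+1} = x_k (1-T)(r_k)$.
\<close>

section \<open>Power series with nonnegative or positive coefficients\<close>

unbundle no vec_syntax

text \<open>In the order on \<open>complex\<close>, \<open>0 \<le> a\<close> also forces
  \<open>a\<close> to be real, so this predicate records realness together with sign.\<close>

definition nonneg_fps :: "complex fps \<Rightarrow> bool" where
  "nonneg_fps F \<longleftrightarrow> (\<forall>n. 0 \<le> F $ n)"

definition pos_fps :: "complex fps \<Rightarrow> bool" where
  "pos_fps F \<longleftrightarrow> (\<forall>n. 0 < F $ n)"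

lemma pos_imp_nonneg_fps: "pos_fps F \<Longrightarrow> nonneg_fps F"
  unfolding pos_fps_def nonneg_fps_def using order_less_imp_le by blast

lemma complex_mult_pos_pos: "0 < a \<Longrightarrow> 0 < b \<Longrightarrow> 0 < a * (b :: complex)"
  by (simp add: less_complex_def)

lemma nonneg_fps_1 [intro]: "nonneg_fps 1"
  by (auto simp: nonneg_fps_def less_eq_complex_def)

lemma nonneg_fps_X [intro]: "nonneg_fps fps_X"
  by (auto simp: nonneg_fps_def less_eq_complex_def)

lemma nonneg_fps_mult [intro]: "nonneg_fps F \<Longrightarrow> nonneg_fps G \<Longrightarrow> nonneg_fps (F * G)"
  by (auto simp: nonneg_fps_def fps_mult_nth intro!: sum_nonneg)

lemma nonneg_fps_power [intro]: "nonneg_fps F \<Longrightarrow> nonneg_fps (F ^ n)"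
  by (induction n) auto

lemma nonneg_fps_compose [intro]: "nonneg_fps F \<Longrightarrow> nonneg_fps G \<Longrightarrow> nonneg_fps (F oo G)"
  using nonneg_fps_power[of G]
  by (auto simp: nonneg_fps_def fps_compose_nth intro!: sum_nonneg)

lemma nonneg_fps_shift [intro]: "nonneg_fps F \<Longrightarrow> nonneg_fps (fps_shift n F)"
  by (auto simp: nonneg_fps_def)

lemma fps_mult_nth_pos:
  assumes "nonneg_fps F" "nonneg_fps G" "0 < F $ i" "0 < G $ j"
  shows "0 < (F * G) $ (i + j)"
proof -
  have "(F * G) $ (i + j) = F $ i * G $ j + (\<Sum>l\<in>{0..i+j}-{i}. F $ l * G $ (i + j - l))"
    unfolding fps_mult_nth by (subst sum.remove[of _ i]) auto
  moreover have "0 \<le> (\<Sum>l\<in>{0..i+j}-{i}. F $ l * G $ (i + j - l))"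
    using assms by (intro sum_nonneg mult_nonneg_nonneg) (auto simp: nonneg_fps_def)
  ultimately show ?thesis
    using complex_mult_pos_pos[OF assms(3,4)] by (simp add: add_pos_nonneg)
qed

lemma pos_fps_mult [intro]: "pos_fps F \<Longrightarrow> pos_fps G \<Longrightarrow> pos_fps (F * G)"
  using fps_mult_nth_pos[of F G 0] pos_imp_nonneg_fps
  by (auto simp: pos_fps_def)

lemma pos_fps_power: "pos_fps F \<Longrightarrow> n \<ge> 1 \<Longrightarrow> pos_fps (F ^ n)"
proof (induction n)
  case (Suc n)
  thus ?case by (cases n) auto
qed simp

text \<open>The inverse \<open>V\<close> satisfies \<open>V = 1 + (1 - F) * V\<close>; the positive
  linear coefficient of \<open>1 - F\<close> carries strict positivity from each coefficient of
  \<open>V\<close> to the next.\<close>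

lemma pos_fps_inverse:
  assumes "F $ 0 = 1" and B: "nonneg_fps (1 - F)" "0 < (1 - F) $ 1"
  shows "pos_fps (inverse F)"
proof -
  define V where "V = inverse F"
  have "F * V = 1"
    unfolding V_def using assms(1) by (simp add: inverse_mult_eq_1')
  hence V: "V = 1 + (1 - F) * V"
    by (simp add: algebra_simps)
  have "0 < V $ n" for n
  proof (induction n rule: less_induct)
    case (less n)
    show ?case
    proof (cases n)
      case 0
      thus ?thesis using assms(1) by (simp add: V_def less_complex_def)
    next
      case (Suc k)
      have "V $ n = (\<Sum>i=0..n. (1 - F) $ i * V $ (n - i))"
        using arg_cong[OF V, of "\<lambda>G. G $ n"] Suc by (simp add: fps_mult_nth)
      also have "\<dots> = (1 - F) $ 1 * V $ k + (\<Sum>i\<in>{0..n}-{1}. (1 - F) $ i * V $ (n - i))"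
        using Suc by (subst sum.remove[of _ 1]) auto
      finally have eq: "V $ n = \<dots>" .
      have "0 \<le> (1 - F) $ i * V $ (n - i)" if "i \<in> {0..n} - {1}" for i
      \<comment> \<open>The term \<open>i = 0\<close> contains \<open>V $ n\<close> itself, which
        the induction does not cover, but its factor \<open>(1 - F) $ 0\<close> is zero.\<close>
      proof (cases "i = 0")
        case False
        hence "0 \<le> V $ (n - i)" using less[of "n - i"] that by (auto intro: order_less_imp_le)
        thus ?thesis using B(1) unfolding nonneg_fps_def by (intro mult_nonneg_nonneg) blast+
      qed (use assms(1) in auto)
      hence "0 \<le> (\<Sum>i\<in>{0..n}-{1}. (1 - F) $ i * V $ (n - i))" by (rule sum_nonneg)
      moreover have "0 < (1 - F) $ 1 * V $ k"
        using B(2) less[of k] Suc by (intro complex_mult_pos_pos) auto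
      ultimately show ?thesis unfolding eq by (simp only: add_pos_nonneg)
    qed
  qed
  thus ?thesis by (simp add: pos_fps_def V_def)
qed

lemma fps_nth_Suc_conv_deriv:
  "F $ Suc n = complex_of_real (1 / real (Suc n)) * fps_deriv F $ n"
  by (simp del: of_nat_Suc)

lemma X_power_dvd_iff: "fps_X ^ n dvd (F :: complex fps) \<longleftrightarrow> (\<forall>i<n. F $ i = 0)"
proof
  assume "fps_X ^ n dvd F"
  thus "\<forall>i<n. F $ i = 0" by (auto elim!: dvdE simp: fps_X_power_mult_nth)
next
  assume "\<forall>i<n. F $ i = 0"
  hence "F = fps_X ^ n * fps_shift n F"
    by (intro fps_ext) (auto simp: fps_X_power_mult_nth)
  thus "fps_X ^ n dvd F" by (rule dvdI)
qed

lemma fps_compose_conv_shift: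
  assumes "F $ 0 = 0" "G $ 0 = 0"
  shows "F oo G = G * (fps_shift 1 F oo (G :: complex fps))"
proof -
  have "F = fps_X * fps_shift 1 F"
    using assms(1) by (intro fps_ext) auto
  hence "F oo G = (fps_X * fps_shift 1 F) oo G" by simp
  thus ?thesis using assms(2) by (simp add: fps_compose_mult_distrib)
qed

text \<open>$F^p - G^p$ is $F - G$ times a series with constant coefficient $p$, which is a unit.\<close>

lemma X_power_dvd_root_unique:
  fixes F G :: "complex fps"
  assumes "fps_X ^ n dvd F ^ p - G ^ p" "F $ 0 = 1" "G $ 0 = 1" "p \<ge> 1"
  shows "fps_X ^ n dvd F - G"
proof -
  define S where "S = (\<Sum>i<p. G ^ (p - Suc i) * F ^ i)"
  have "S $ 0 = of_nat p"
    using assms by (simp add: S_def fps_sum_nth fps_nth_power_0)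
  hence "S dvd 1" using assms(4) by (simp add: fps_is_unit_iff)
  moreover have "F ^ p - G ^ p = (F - G) * S"
    unfolding S_def by (rule power_diff_sumr2)
  ultimately show ?thesis using assms(1) by (simp add: dvd_mult_unit_iff)
qed

section \<open>Binomial coefficients of the p-th root\<close>

lemma root_coeff_0 [simp]: "root_coeff p 0 = 1"
  by (simp add: root_coeff_def)

lemma root_coeff_Suc: "real (Suc i) * root_coeff p (Suc i) = (real i - 1 / real p) * root_coeff p i"
  by (simp add: root_coeff_def pochhammer_rec' field_simps del: of_nat_Suc)

lemma root_coeff_neg:
  assumes "p \<ge> 2" "i \<ge> 1"
  shows "root_coeff p i < 0"
  using assms(2)
proof (induction i rule: dec_induct)
  case base
  show ?case using assms(1) by (simp add: root_coeff_def)
next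
  case (step i)
  have "1 / real p < 1" using assms(1) by simp
  hence "0 < real i - 1 / real p" using step.hyps by linarith
  hence "real (Suc i) * root_coeff p (Suc i) < 0"
    unfolding root_coeff_Suc using step.IH by (rule mult_pos_neg)
  thus ?case by (simp add: mult_less_0_iff)
qed

text \<open>This closed form for the value of the truncation at 1 shows that the value is
  positive.\<close>

lemma sum_root_coeff: "(\<Sum>i\<le>m. root_coeff p i) = pochhammer (1 - 1 / real p) m / fact m"
proof (induction m)
  case (Suc m)
  let ?a = "pochhammer (1 - 1 / real p) m"
  have "(\<Sum>i\<le>Suc m. root_coeff p i) = ?a / fact m + (- 1 / real p) * ?a / fact (Suc m)"
    using Suc by (simp add: root_coeff_def pochhammer_rec)
  also have "?a / fact m = real (Suc m) * ?a / fact (Suc m)"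
    by (simp del: of_nat_Suc)
  also have "real (Suc m) * ?a / fact (Suc m) + (- 1 / real p) * ?a / fact (Suc m) =
      (1 - 1 / real p + real m) * ?a / fact (Suc m)"
    by (simp only: add_divide_distrib[symmetric]) (simp add: algebra_simps del: fact_Suc)
  also have "(1 - 1 / real p + real m) * ?a = pochhammer (1 - 1 / real p) (Suc m)"
    by (simp only: pochhammer_rec')
  finally show ?case .
qed simp

section \<open>The truncated series and the residual map\<close>

locale schroeder =
  fixes p m :: nat
  assumes p_ge_2: "p \<ge> 2" and m_ge_1: "m \<ge> 1"
begin

definition T :: "complex fps" where
  "T = Abs_fps (\<lambda>i. if i \<le> m then of_real (root_coeff p i) else 0)"

definition V :: "complex fps" where "V = inverse T"

definition f :: "complex fps" where "f = 1 - (1 - fps_X) * V ^ p"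

text \<open>The defect that truncation at degree \<open>m\<close> leaves in the differential
  equation; for \<open>m \<ge> 1\<close> both factors are negative.\<close>

definition c :: real where "c = root_coeff p m * (1 - real p * real m)"

lemma T_nth: "T $ i = (if i \<le> m then of_real (root_coeff p i) else 0)"
  by (simp add: T_def)

lemma T_nth_0 [simp]: "T $ 0 = 1"
  by (simp add: T_nth)

lemma TV: "T * V = 1"
  by (simp add: V_def inverse_mult_eq_1')

lemma nonneg_1_minus_T: "nonneg_fps (1 - T)"
  using root_coeff_neg[OF p_ge_2]
  by (auto simp: nonneg_fps_def T_nth less_eq_complex_def intro: less_imp_le)

lemma one_minus_T_nth_1: "0 < (1 - T) $ 1"
  using root_coeff_neg[OF p_ge_2, of 1] m_ge_1 by (simp add: T_nth less_complex_def)

lemma pos_V: "pos_fps V"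
  unfolding V_def using nonneg_1_minus_T one_minus_T_nth_1 by (intro pos_fps_inverse) auto

lemma c_pos: "c > 0"
proof -
  have "p * m \<ge> 2 * 1" using p_ge_2 m_ge_1 by (intro mult_le_mono)
  hence "1 - real p * real m < 0" by (simp flip: of_nat_mult)
  thus ?thesis unfolding c_def using root_coeff_neg[OF p_ge_2 m_ge_1] by (intro mult_neg_neg)
qed

text \<open>Below degree \<open>m\<close> the recurrence of the binomial coefficients cancels
  everything, and above it all terms vanish. At degree \<open>m\<close> the missing next coefficient
  leaves \<open>c\<close>.\<close>

lemma T_ode: "T + of_nat p * (1 - fps_X) * fps_deriv T = fps_const (of_real c) * fps_X ^ m"
proof (rule fps_ext)
  fix n
  have rec: "complex_of_real (root_coeff p (Suc n)) * (1 + of_nat n) =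
     (of_nat n - 1 / of_nat p) * of_real (root_coeff p n)"
    using arg_cong[OF root_coeff_Suc[of n p], of complex_of_real] by (simp add: algebra_simps)
  have "(T + of_nat p * (1 - fps_X) * fps_deriv T) $ n =
     T $ n + of_nat p * (of_nat (Suc n) * T $ Suc n - of_nat n * T $ n)"
    by (cases n) (simp_all add: algebra_simps fps_mult_of_nat_nth)
  also have "\<dots> = (fps_const (of_real c) * fps_X ^ m) $ n"
    using p_ge_2 rec by (auto simp: T_nth c_def field_simps)
  finally show "(T + of_nat p * (1 - fps_X) * fps_deriv T) $ n =
    (fps_const (of_real c) * fps_X ^ m) $ n" .
qed

lemma deriv_V: "fps_deriv V = - fps_deriv T * V ^ 2"
  by (simp add: V_def fps_inverse_deriv)

lemma deriv_V_power: "fps_deriv (V ^ n) = - of_nat n * fps_deriv T * V ^ (n + 1)"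
  unfolding fps_deriv_power' deriv_V by (cases n) (simp_all add: power2_eq_square algebra_simps)

lemma deriv_f: "fps_deriv f = fps_const (of_real c) * fps_X ^ m * V ^ (p + 1)"
proof -
  have "fps_deriv f = V ^ p + (of_nat p * (1 - fps_X) * fps_deriv T) * V ^ (p + 1)"
    by (simp add: f_def deriv_V_power algebra_simps)
  also have "of_nat p * (1 - fps_X) * fps_deriv T = fps_const (of_real c) * fps_X ^ m - T"
    using T_ode by (simp add: algebra_simps)
  also have "V ^ p + (fps_const (of_real c) * fps_X ^ m - T) * V ^ (p + 1) =
     fps_const (of_real c) * fps_X ^ m * V ^ (p + 1) + V ^ p * (1 - T * V)"
    by (simp add: algebra_simps)
  finally show ?thesis by (simp add: TV)
qed

lemma f_nth_0: "f $ 0 = 0"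
  by (simp add: f_def V_def fps_nth_power_0)

lemma nonneg_const_X_power: "nonneg_fps (fps_const (of_real c) * fps_X ^ m)"
  using c_pos by (auto simp: nonneg_fps_def less_eq_complex_def)

lemma nonneg_f: "nonneg_fps f"
proof -
  have "nonneg_fps (fps_deriv f)"
    unfolding deriv_f
    by (intro nonneg_fps_mult nonneg_const_X_power nonneg_fps_power pos_imp_nonneg_fps pos_V)
  hence "0 \<le> f $ Suc n" for n
    unfolding fps_nth_Suc_conv_deriv
    by (intro mult_nonneg_nonneg) (auto simp: nonneg_fps_def less_eq_complex_def)
  hence "0 \<le> f $ n" for n by (cases n) (auto simp: f_nth_0)
  thus ?thesis by (simp add: nonneg_fps_def)
qed

text \<open>The derivative of \<open>f\<close> has the factor \<open>fps_X ^ m\<close>, so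
  \<open>f\<close> vanishes to order \<open>m + 1\<close>: this is the convergence order of the
  method.\<close>

lemma f_nth_eq_0: "n \<le> m \<Longrightarrow> f $ n = 0"
proof (cases n)
  case (Suc k)
  assume "n \<le> m"
  thus ?thesis
    unfolding Suc fps_nth_Suc_conv_deriv deriv_f
    using Suc by (simp add: mult.assoc fps_X_power_mult_nth)
qed (simp add: f_nth_0)

lemma T_power_mult: "T ^ p * (1 - f) = 1 - fps_X"
proof -
  have "T ^ p * (1 - f) = (1 - fps_X) * (T * V) ^ p"
    by (simp add: f_def algebra_simps power_mult_distrib)
  thus ?thesis by (simp add: TV)
qed

text \<open>Strictness comes from the summand \<open>V ^ q\<close> in the derivative of
  \<open>W\<close>. It is what makes the coefficients of \<open>X 2\<close> negative beyond degree
  \<open>m\<close>.\<close>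

lemma Tf_nth_pos:
  assumes "n > m"
  shows "0 < (T * f) $ n"
proof -
  \<comment> \<open>With \<open>q = p - 1\<close>, the power of \<open>T\<close> with exponent
    \<open>1 - p\<close> becomes \<open>V ^ q\<close>, and \<open>q \<ge> 1\<close> makes its
    coefficients strictly positive.\<close>
  obtain q where q: "p = Suc q" "q \<ge> 1" using p_ge_2 by (cases p) auto
  have Vp: "V ^ p = V * V ^ q" "of_nat p = (of_nat q + 1 :: complex fps)" by (simp_all add: q)
  obtain k where k: "n = Suc k" using assms by (cases n) auto
  define W where "W = (1 - fps_X) * V ^ q"
  define K where "K = fps_const (complex_of_real c) * fps_X ^ m"
  have "T * f = T - (1 - fps_X) * V ^ q * (T * V)"
    by (simp add: f_def Vp algebra_simps)
  hence Tf: "T * f = T - W" by (simp add: TV W_def)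
  have "of_nat p * fps_deriv W =
      - of_nat p * V ^ q - of_nat q * V ^ p * (of_nat p * (1 - fps_X) * fps_deriv T)"
    by (simp add: W_def deriv_V_power Vp(1) algebra_simps)
  also have "of_nat p * (1 - fps_X) * fps_deriv T = K - T"
    using T_ode by (simp add: algebra_simps K_def)
  also have "- of_nat p * V ^ q - of_nat q * V ^ p * (K - T) =
     - of_nat p * V ^ q - of_nat q * V ^ p * K + of_nat q * V ^ q * (T * V)"
    by (simp add: Vp(1) algebra_simps)
  also have "\<dots> = - (V ^ q + of_nat q * V ^ p * K)"
    by (simp add: TV Vp algebra_simps)
  finally have "of_nat p * fps_deriv W = - (V ^ q + of_nat q * V ^ p * K)" .
  hence "of_nat p * fps_deriv W $ k = - (V ^ q $ k + of_nat q * (V ^ p * K) $ k)"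
    by (metis fps_add_nth fps_mult_of_nat_nth(1) fps_neg_nth mult.assoc)
  moreover have "0 < V ^ q $ k"
    using pos_fps_power[OF pos_V q(2)] by (simp add: pos_fps_def)
  moreover have "0 \<le> (V ^ p * K) $ k"
    using nonneg_fps_mult[OF nonneg_fps_power[OF pos_imp_nonneg_fps[OF pos_V], of p] nonneg_const_X_power]
    by (simp add: nonneg_fps_def K_def)
  ultimately have "0 < of_nat p * - (fps_deriv W $ k)"
    by (simp add: less_complex_def less_eq_complex_def add_nonneg_pos)
  hence "0 < - (fps_deriv W $ k)"
    by (auto simp: less_complex_def zero_less_mult_iff mult_less_0_iff)
  hence "0 < complex_of_real (1 / real (Suc k)) * - (fps_deriv W $ k)"
    by (intro complex_mult_pos_pos) (simp_all add: less_complex_def)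
  hence "0 < - (W $ n)"
    unfolding k fps_nth_Suc_conv_deriv[of W] by (simp only: mult_minus_right)
  thus ?thesis using assms by (simp add: Tf T_nth)
qed

lemma Tf_nth_eq_0: "n \<le> m \<Longrightarrow> (T * f) $ n = 0"
  by (simp add: fps_mult_nth f_nth_eq_0)

lemma nonneg_Tf: "nonneg_fps (T * f)"
  unfolding nonneg_fps_def using Tf_nth_pos Tf_nth_eq_0
  by (metis linorder_not_less order_less_imp_le order_refl)

section \<open>Formal series of the iterates and residuals\<close>

text \<open>
  The upper-case \<open>R k\<close> and \<open>X k\<close> are the power series of the functions \<open>r k\<close> and \<open>x k\<close>, and
  \<open>f\<close> is that of \<open>\<phi>\<close>.
\<close>

definition x :: "nat \<Rightarrow> complex \<Rightarrow> complex" where "x k z = schroeder_iter p m k z"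

definition r :: "nat \<Rightarrow> complex \<Rightarrow> complex" where "r k z = 1 - (1 - z) / x k z ^ p"

definition \<phi> :: "complex \<Rightarrow> complex" where "\<phi> t = 1 - (1 - t) / root_taylor p m t ^ p"

primrec R :: "nat \<Rightarrow> complex fps" where
  "R 0 = fps_X"
| "R (Suc k) = f oo R k"

primrec X :: "nat \<Rightarrow> complex fps" where
  "X 0 = 1"
| "X (Suc k) = X k * (T oo R k)"

lemma R_nth_0 [simp]: "R k $ 0 = 0"
  by (induction k) (auto simp: f_nth_0)

lemma X_nth_0 [simp]: "X k $ 0 = 1"
  by (induction k) auto

lemma nonneg_R: "nonneg_fps (R k)"
  by (induction k) (auto intro: nonneg_f)

lemma XR_Suc: "X (Suc k) * R (Suc k) = (X k * R k) * (fps_shift 1 (T * f) oo R k)"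
proof -
  have "X (Suc k) * R (Suc k) = X k * ((T * f) oo R k)"
    by (simp add: fps_compose_mult_distrib)
  also have "(T * f) oo R k = R k * (fps_shift 1 (T * f) oo R k)"
    by (rule fps_compose_conv_shift) (simp_all add: f_nth_0)
  finally show ?thesis by (simp add: mult.assoc)
qed

text \<open>For \<open>k \<ge> 1\<close> the series \<open>X k\<close> has negative coefficients, so
  the sign has to be carried by the product with \<open>R k\<close>.\<close>

lemma nonneg_XR: "nonneg_fps (X k * R k)"
proof (induction k)
  case (Suc k)
  show ?case unfolding XR_Suc
    by (intro nonneg_fps_mult[OF Suc] nonneg_fps_compose nonneg_fps_shift nonneg_Tf nonneg_R)
qed (simp add: nonneg_fps_X)

lemma X_diff: "X k - X (Suc k) = (X k * R k) * (fps_shift 1 (1 - T) oo R k)"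
proof -
  have "X k - X (Suc k) = X k * ((1 - T) oo R k)"
    by (simp add: fps_compose_sub_distrib algebra_simps)
  also have "(1 - T) oo R k = R k * (fps_shift 1 (1 - T) oo R k)"
    by (rule fps_compose_conv_shift) simp_all
  finally show ?thesis by (simp add: mult.assoc)
qed

lemma nonneg_X_diff: "nonneg_fps (X k - X (Suc k))"
  unfolding X_diff
  by (intro nonneg_fps_mult nonneg_XR nonneg_fps_compose nonneg_fps_shift nonneg_1_minus_T nonneg_R)

lemma X_1: "X 1 = T"
  by simp

text \<open>Up to degree \<open>m\<close> the coefficients of \<open>X 1 = T\<close> are already
  negative and can only decrease. Beyond \<open>m\<close> they are zero, and the drop to
  \<open>X 2\<close> is strict.\<close>

lemma X_2_nth_neg:
  assumes "i \<ge> 1"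
  shows "X 2 $ i < 0"
proof -
  have diff: "0 \<le> X 1 $ i - X 2 $ i"
    using nonneg_X_diff[of 1] by (simp add: nonneg_fps_def numeral_2_eq_2)
  show ?thesis
  proof (cases "i \<le> m")
    case True
    hence "X 1 $ i < 0"
      using root_coeff_neg[OF p_ge_2 assms] unfolding X_1 by (simp add: T_nth less_complex_def)
    thus ?thesis using diff by (simp add: less_complex_def less_eq_complex_def)
  next
    case False
    have "X 1 - X 2 = (T * f) * (fps_shift 1 (1 - T) oo f)"
      using X_diff[of 1] by (simp add: numeral_2_eq_2)
    \<comment> \<open>Writing \<open>i + 0\<close> pairs coefficient \<open>i\<close> of
      \<open>T * f\<close> with the constant term \<open>(1 - T) $ 1\<close> of the other
      factor.\<close>
    moreover have "0 < ((T * f) * (fps_shift 1 (1 - T) oo f)) $ (i + 0)"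
      using False one_minus_T_nth_1
      by (intro fps_mult_nth_pos nonneg_Tf nonneg_fps_compose nonneg_fps_shift
            nonneg_1_minus_T nonneg_f Tf_nth_pos) simp_all
    ultimately have "0 < X 1 $ i - X 2 $ i" by (metis add_0_right fps_sub_nth)
    thus ?thesis using False unfolding X_1 by (simp add: T_nth less_complex_def)
  qed
qed

lemma X_power_mult: "X k ^ p * (1 - R k) = 1 - fps_X"
proof (induction k)
  case (Suc k)
  have "X (Suc k) ^ p * (1 - R (Suc k)) = X k ^ p * ((T ^ p * (1 - f)) oo R k)"
    by (simp add: fps_compose_mult_distrib fps_compose_sub_distrib fps_compose_power
          power_mult_distrib mult.assoc)
  also have "\<dots> = X k ^ p * (1 - R k)"
    unfolding T_power_mult by (simp add: fps_compose_sub_distrib)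
  finally show ?case using Suc by simp
qed simp

text \<open>Since \<open>f\<close> vanishes at least to second order, each composition raises the
  order of vanishing by at least one.\<close>

lemma X_power_dvd_R: "fps_X ^ Suc k dvd R k"
proof (induction k)
  case (Suc k)
  have "fps_X ^ 2 dvd f"
    using m_ge_1 by (auto simp: X_power_dvd_iff intro!: f_nth_eq_0)
  then obtain g where g: "f = fps_X ^ 2 * g" by (elim dvdE)
  have "R (Suc k) = R k * (R k * (g oo R k))"
    by (simp add: g fps_compose_mult_distrib fps_compose_power[symmetric] power2_eq_square mult.assoc)
  moreover have "fps_X ^ Suc k * fps_X dvd R k * (R k * (g oo R k))"
    using Suc by (intro mult_dvd_mono dvd_mult2) (auto intro: dvd_trans[rotated])
  ultimately show ?case by (simp add: mult.commute)
qed simp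

end

section \<open>Stabilisation at the binomial coefficients\<close>

text \<open>
  Both $x_k$ and the truncation of degree $i$ are $p$-th roots of $1 - z$ modulo $z^{i+1}$, so
  the latter plays the role of the full binomial series.
\<close>

lemma (in schroeder) X_nth_eq:
  assumes "1 \<le> i" "i \<le> k"
  shows "X k $ i = of_real (root_coeff p i)"
proof -
  \<comment> \<open>The same theory with truncation degree \<open>i\<close> in place of
    \<open>m\<close>: \<open>S.T\<close> contains the wanted coefficient
    \<open>root_coeff p i\<close>, and \<open>S.f\<close> vanishes to order
    \<open>i + 1\<close>.\<close>
  interpret S: schroeder p i using p_ge_2 assms by unfold_locales
  have "fps_X ^ Suc i dvd R k"
    by (rule dvd_trans[OF le_imp_power_dvd X_power_dvd_R]) (use assms in simp)
  moreover have "fps_X ^ Suc i dvd S.f"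
    by (simp add: X_power_dvd_iff S.f_nth_eq_0 del: power_Suc)
  ultimately have dvd: "fps_X ^ Suc i dvd X k ^ p * R k - S.T ^ p * S.f"
    by (intro dvd_diff dvd_mult)
  have "X k ^ p * R k = X k ^ p - (1 - fps_X)"
    unfolding X_power_mult[of k, symmetric] by (simp add: right_diff_distrib)
  moreover have "S.T ^ p * S.f = S.T ^ p - (1 - fps_X)"
    unfolding S.T_power_mult[symmetric] by (simp add: right_diff_distrib)
  ultimately have "fps_X ^ Suc i dvd X k ^ p - S.T ^ p"
    using dvd by simp
  hence "fps_X ^ Suc i dvd X k - S.T"
    by (rule X_power_dvd_root_unique) (use p_ge_2 in simp_all)
  thus ?thesis by (simp add: X_power_dvd_iff S.T_nth del: power_Suc)
qed

section \<open>Holomorphy and expansions on the unit disc\<close>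

context schroeder
begin

lemma x_Suc: "x (Suc k) z = x k z * root_taylor p m (r k z)"
  by (simp add: x_def r_def)

lemma r_Suc: "r (Suc k) z = \<phi> (r k z)"
proof -
  have "1 - r k z = (1 - z) / x k z ^ p" by (simp add: r_def)
  thus ?thesis unfolding r_def[of "Suc k"] x_Suc \<phi>_def by (simp add: power_mult_distrib)
qed

lemma root_taylor_expansion: "root_taylor p m has_fps_expansion T"
proof -
  have "(\<lambda>t. \<Sum>i\<le>m. complex_of_real (root_coeff p i) * t ^ i) has_fps_expansion
          (\<Sum>i\<le>m. fps_const (of_real (root_coeff p i)) * fps_X ^ i)"
    by (intro has_fps_expansion_sum has_fps_expansion_cmult_left has_fps_expansion_fps_X_power)
  also have "(\<Sum>i\<le>m. fps_const (of_real (root_coeff p i)) * fps_X ^ i) = T"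
    by (intro fps_ext) (auto simp: fps_sum_nth T_nth if_distrib cong: if_cong)
  finally show ?thesis unfolding root_taylor_def .
qed

lemma root_taylor_holomorphic: "root_taylor p m holomorphic_on A"
  unfolding root_taylor_def by (intro holomorphic_intros)

text \<open>All nonconstant coefficients are negative, so the triangle inequality bounds
  \<open>1 - T\<close> at \<open>t\<close> by its value at \<open>norm t\<close>.\<close>

lemma norm_1_minus_root_taylor:
  "norm (1 - root_taylor p m t) \<le> 1 - (\<Sum>i\<le>m. root_coeff p i * norm t ^ i)"
proof -
  have split: "(\<Sum>i\<le>m. g i) = g 0 + (\<Sum>i\<in>{1..m}. g i)"
    for g :: "nat \<Rightarrow> 'a :: comm_monoid_add"
    by (simp add: atMost_atLeast0 sum.atLeast_Suc_atMost)
  have "norm (1 - root_taylor p m t) = norm (\<Sum>i\<in>{1..m}. of_real (root_coeff p i) * t ^ i)"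
    unfolding root_taylor_def split by (simp add: norm_minus_cancel)
  also have "\<dots> \<le> (\<Sum>i\<in>{1..m}. norm (of_real (root_coeff p i) * t ^ i))"
    by (rule norm_sum)
  also have "\<dots> = (\<Sum>i\<in>{1..m}. - (root_coeff p i * norm t ^ i))"
    using root_coeff_neg[OF p_ge_2] by (intro sum.cong) (auto simp: norm_mult norm_power abs_of_neg)
  also have "\<dots> = 1 - (\<Sum>i\<le>m. root_coeff p i * norm t ^ i)"
    unfolding split by (simp add: sum_negf)
  finally show ?thesis .
qed

text \<open>Negative coefficients make the truncation smallest at \<open>s = 1\<close>, where
  \<open>sum_root_coeff\<close> applies.\<close>

lemma root_taylor_real_pos:
  assumes "0 \<le> s" "s \<le> 1"
  shows "0 < (\<Sum>i\<le>m. root_coeff p i * s ^ i)"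
proof -
  have "0 < (\<Sum>i\<le>m. root_coeff p i)"
    unfolding sum_root_coeff using p_ge_2 by (intro divide_pos_pos pochhammer_pos) auto
  also have "\<dots> \<le> (\<Sum>i\<le>m. root_coeff p i * s ^ i)"
  proof (rule sum_mono)
    fix i
    show "root_coeff p i \<le> root_coeff p i * s ^ i"
      using root_coeff_neg[OF p_ge_2, of i] power_le_one[of s i] assms
      by (cases "i = 0") (auto simp: mult_le_cancel_left1)
  qed
  finally show ?thesis .
qed

lemma root_taylor_nonzero:
  assumes "norm t \<le> 1"
  shows "root_taylor p m t \<noteq> 0"
  using norm_1_minus_root_taylor[of t] root_taylor_real_pos[of "norm t"] assms by auto

lemma \<phi>_holomorphic: "\<phi> holomorphic_on ball 0 1"
  unfolding \<phi>_def using root_taylor_nonzero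
  by (intro holomorphic_intros root_taylor_holomorphic) auto

lemma \<phi>_expansion: "\<phi> has_fps_expansion f"
proof -
  have "(\<lambda>t. 1 - (1 - t) * inverse (root_taylor p m t) ^ p) has_fps_expansion f"
    unfolding f_def V_def by (intro fps_expansion_intros root_taylor_expansion) auto
  thus ?thesis unfolding \<phi>_def by (simp add: field_simps)
qed

text \<open>Keeps all residuals in the unit disc, where \<open>\<phi>\<close> is holomorphic, so
  that the iteration stays holomorphic.\<close>

lemma norm_\<phi>_less_1:
  assumes "norm t < 1"
  shows "norm (\<phi> t) < 1"
proof -
  define s where "s = norm t"
  define u where "u = (\<Sum>i\<le>m. root_coeff p i * s ^ i)"
  have s: "0 \<le> s" "s < 1" using assms by (auto simp: s_def)
  have u: "u > 0" unfolding u_def using s by (intro root_taylor_real_pos) auto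
  have sums: "(\<lambda>n. f $ n * z ^ n) sums \<phi> z" if "norm z < 1" for z
    using that \<phi>_holomorphic
    by (intro has_fps_expansion_imp_sums_complex[OF \<phi>_expansion, of 1]) (auto simp: one_ereal_def)
  have f_nonneg: "0 \<le> Re (f $ n)" "f $ n = of_real (Re (f $ n))" for n
    using nonneg_f by (auto simp: nonneg_fps_def less_eq_complex_def complex_eq_iff)
  have norm_f: "norm (f $ n * t ^ n) = Re (f $ n) * s ^ n" for n
    by (subst f_nonneg(2)) (simp add: norm_mult norm_power s_def f_nonneg(1))
  \<comment> \<open>At the real point \<open>s\<close> the majorant series has an explicit sum,
    visibly below 1 because \<open>s < 1\<close> and \<open>u > 0\<close>.\<close>
  have "\<phi> (of_real s) = of_real (1 - (1 - s) / u ^ p)"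
    by (simp add: \<phi>_def root_taylor_def u_def)
  hence "(\<lambda>n. f $ n * of_real s ^ n) sums of_real (1 - (1 - s) / u ^ p)"
    using sums[of "of_real s"] s by simp
  hence "(\<lambda>n. Re (f $ n * of_real s ^ n)) sums (1 - (1 - s) / u ^ p)"
    using sums_Re by fastforce
  also have "(\<lambda>n. Re (f $ n * of_real s ^ n)) = (\<lambda>n. Re (f $ n) * s ^ n)"
    by (simp flip: of_real_power)
  finally have sums': "(\<lambda>n. norm (f $ n * t ^ n)) sums (1 - (1 - s) / u ^ p)"
    unfolding norm_f .
  have "norm (\<phi> t) = norm (\<Sum>n. f $ n * t ^ n)"
    using sums[OF assms] by (simp add: sums_iff)
  also have "\<dots> \<le> (\<Sum>n. norm (f $ n * t ^ n))"
    using sums' by (intro summable_norm) (simp add: sums_iff)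
  also have "\<dots> = 1 - (1 - s) / u ^ p"
    using sums' by (simp add: sums_iff)
  also have "\<dots> < 1" using s u by simp
  finally show ?thesis .
qed

lemma norm_r_less_1: "norm z < 1 \<Longrightarrow> norm (r k z) < 1"
  by (induction k) (auto simp: r_Suc norm_\<phi>_less_1, simp add: r_def x_def)

lemma r_holomorphic: "r k holomorphic_on ball 0 1"
proof (induction k)
  case 0
  show ?case unfolding r_def x_def by (auto intro!: holomorphic_intros)
next
  case (Suc k)
  have "(\<phi> \<circ> r k) holomorphic_on ball 0 1"
    using Suc \<phi>_holomorphic norm_r_less_1 by (intro holomorphic_on_compose_gen) auto
  thus ?case by (simp add: r_Suc[abs_def] o_def)
qed

lemma x_holomorphic: "x k holomorphic_on ball 0 1"
proof (induction k)
  case 0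
  show ?case unfolding x_def by (auto intro!: holomorphic_intros)
next
  case (Suc k)
  have "(root_taylor p m \<circ> r k) holomorphic_on ball 0 1"
    by (intro holomorphic_on_compose r_holomorphic root_taylor_holomorphic)
  thus ?case using Suc by (auto simp: x_Suc[abs_def] o_def intro!: holomorphic_intros)
qed

lemma r_expansion: "r k has_fps_expansion R k"
proof (induction k)
  case 0
  show ?case by (simp add: r_def[abs_def] x_def fps_expansion_intros)
next
  case (Suc k)
  have "(\<phi> \<circ> r k) has_fps_expansion (f oo R k)"
    by (intro has_fps_expansion_compose \<phi>_expansion Suc) simp
  thus ?case by (simp add: r_Suc[abs_def] o_def)
qed

lemma x_expansion: "x k has_fps_expansion X k"
proof (induction k)
  case 0
  show ?case by (simp add: x_def[abs_def])
next
  case (Suc k)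
  have "(root_taylor p m \<circ> r k) has_fps_expansion (T oo R k)"
    by (intro has_fps_expansion_compose root_taylor_expansion r_expansion) simp
  hence "(\<lambda>z. x k z * (root_taylor p m \<circ> r k) z) has_fps_expansion X k * (T oo R k)"
    by (intro has_fps_expansion_mult Suc)
  thus ?case by (simp add: x_Suc[abs_def])
qed

lemma X_nth_mono: "X (Suc k) $ i \<le> X k $ i"
  using nonneg_X_diff[of k] by (simp add: nonneg_fps_def)

lemma X_nth_antimono: "j \<le> k \<Longrightarrow> X k $ i \<le> X j $ i"
  by (rule lift_Suc_antimono_le[of "\<lambda>k. X k $ i"]) (rule X_nth_mono)

lemma X_nth_nonpos: "i \<ge> 1 \<Longrightarrow> X k $ i \<le> 0"
  using X_nth_antimono[of 0 k i] by simp

text \<open>Being comparable with 0 in the complex order forces a zero imaginary part.\<close>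

lemma of_real_Re_X_nth: "of_real (Re (X k $ i)) = X k $ i"
  using X_nth_nonpos[of i k] by (cases "i = 0") (auto simp: less_eq_complex_def complex_eq_iff)

lemma x_sums:
  assumes "norm z < 1"
  shows "(\<lambda>i. of_real (Re (X k $ i)) * z ^ i) sums schroeder_iter p m k z"
  using has_fps_expansion_imp_sums_complex[OF x_expansion, of k 1 z] x_holomorphic[of k] assms
  by (simp add: of_real_Re_X_nth one_ereal_def x_def)

text \<open>Existence is \<open>x_sums\<close>; uniqueness follows because any other such expansion
  gives a formal series of the same function at 0.\<close>

lemma schroeder_coeff_eq: "schroeder_coeff p m k = (\<lambda>i. Re (X k $ i))"
  unfolding schroeder_coeff_def
proof (rule the_equality)
  fix d :: "nat \<Rightarrow> real"
  assume d: "\<forall>z. norm z < 1 \<longrightarrow> (\<lambda>i. of_real (d i) * z ^ i) sums schroeder_iter p m k z"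
  define D where "D = Abs_fps (\<lambda>i. complex_of_real (d i))"
  have "x k has_fps_expansion D"
    using d by (intro has_fps_expansionI eventually_nhds_ball[of 1, THEN eventually_mono])
               (auto simp: D_def x_def)
  hence "D = X k" using x_expansion fps_expansion_unique_complex by blast
  hence "complex_of_real (d i) = X k $ i" for i by (simp add: D_def flip: \<open>D = X k\<close>)
  thus "d = (\<lambda>i. Re (X k $ i))" by (metis Re_complex_of_real)
qed (use x_sums in blast)

end

theorem theorem6:
  fixes p m :: nat
  assumes "p \<ge> 2" and "m \<ge> 1"
  shows "(\<forall>k z. norm z < 1 \<longrightarrow>
            (\<lambda>i. of_real (schroeder_coeff p m k i) * z ^ i) sums schroeder_iter p m k z)
       \<and> (\<forall>i\<ge>1. (\<forall>k. schroeder_coeff p m (Suc k) i \<le> schroeder_coeff p m k i)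
               \<and> (\<exists>K. \<forall>k\<ge>K. schroeder_coeff p m k i = root_coeff p i))
       \<and> (\<forall>k. \<forall>i\<ge>1. schroeder_coeff p m k i \<le> 0)
       \<and> (\<forall>k\<ge>2. \<forall>i\<ge>1. schroeder_coeff p m k i < 0)"
proof -
  interpret schroeder p m using assms by unfold_locales
  have mono: "Re (X k $ i) \<le> Re (X j $ i)" if "j \<le> k" for i j k
    using X_nth_antimono[OF that, of i] by (simp add: less_eq_complex_def)
  \<comment> \<open>\<open>X_nth_eq\<close> supplies the threshold \<open>K = i\<close>.\<close>
  have stable: "\<exists>K. \<forall>k\<ge>K. Re (X k $ i) = root_coeff p i" if "1 \<le> i" for i
    using X_nth_eq[OF that] by (metis Re_complex_of_real)
  have nonpos: "Re (X k $ i) \<le> 0" if "1 \<le> i" for i k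
    using X_nth_nonpos[OF that, of k] by (simp add: less_eq_complex_def)
  have neg: "Re (X k $ i) < 0" if "1 \<le> i" "2 \<le> k" for i k
    using mono[OF that(2), of i] X_2_nth_neg[OF that(1)] by (simp add: less_complex_def)
  show ?thesis
    unfolding schroeder_coeff_eq
    by (intro conjI allI impI x_sums mono stable nonpos neg) simp_all
qed

end
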